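(* Let $\mathbb{K}$ be a field, let $P$ be a finite partially ordered set, and let $C$ be a component module over $P$ with at least two generators, at least one of which is a minimal generator. Then $C$ decomposes as a direct sum of an interval module over $P$ and a non-trivial (i.e. non-zero) semi-component module over $P$.
   Context: A partially ordered set $P$ is viewed as a category with one object for each element and a unique morphism $p\to q$ whenever $p\le q$. A persistence module over $P$ is a functor from $P$ to the category of finite-dimensional $\mathbb{K}$-vector spaces and linear maps; it is called finite if $P$ is finite. Direct sums are taken objectwise. A persistence module $M$ over $P$ is a component module if there is a choice of basis of every vector space $M(q)$, $q\in P$ (together called a component basis of $M$), such that for every morphism $\alpha\colon q\to p$ in $P$ the matrix of $M(\alpha)$ with respect to these bases contains only zeros and ones, with exactly one $1$ in each column. If instead the matrices contain only zeros and ones with at most one $1$ in each column, $M$ is called a semi-component module. An element of the component basis in $M(q)$ is called a generator if it is not in the image of $M(\alpha)$ for any non-identity morphism $\alpha\colon p\to q$ in $P$. A generator in $M(p)$ is a minimal generator if $p\le q$ for every $q\in P$ such that $M(q)$ contains a generator. A persistence module $M$ over $P$ is an interval module if: (1) for every $p\in P$, $M(p)$ is isomorphic to $\mathbb{K}$ or $0$; (2) bases can be chosen simultaneously such that for every morphism $\alpha\colon q\to p$ with $M(q)\cong M(p)\cong\mathbb{K}$ the map $M(\alpha)$ is the identity; (3) for morphisms $q\to p$ and $p\to l$ in $P$, if $M(q)\cong M(l)\cong\mathbb{K}$ then $M(p)\cong\mathbb{K}$. *)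

theory Defs
  imports "HOL-Analysis.Product_Vector"
begin

text \<open>
  A finite partially ordered set is a type of class \<open>{finite, order}\<close>. The vector spaces of a
  persistence module are linear subspaces of one ambient vector space, given by a scalar
  multiplication \<open>s\<close> on a type of class \<open>ab_group_add\<close>. This loses no generality: any family of
  vector spaces embeds into its direct sum, and the ambient space need not be finite-dimensional.
  Linear maps are functions on the ambient type of which only the values on the relevant subspace
  matter, and \<open>pm_map M q p\<close> is meaningful only if \<open>q \<le> p\<close>.
\<close>

definition linear_on ::
    "('k::field \<Rightarrow> 'v::ab_group_add \<Rightarrow> 'v) \<Rightarrow> ('k \<Rightarrow> 'w::ab_group_add \<Rightarrow> 'w) \<Rightarrow>
     'v set \<Rightarrow> 'w set \<Rightarrow> ('v \<Rightarrow> 'w) \<Rightarrow> bool" where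
  "linear_on s t V W f \<longleftrightarrow>
     (\<forall>x\<in>V. f x \<in> W) \<and>
     (\<forall>x\<in>V. \<forall>y\<in>V. f (x + y) = f x + f y) \<and>
     (\<forall>c. \<forall>x\<in>V. f (s c x) = t c (f x))"

definition linear_iso_on ::
    "('k::field \<Rightarrow> 'v::ab_group_add \<Rightarrow> 'v) \<Rightarrow> ('k \<Rightarrow> 'w::ab_group_add \<Rightarrow> 'w) \<Rightarrow>
     'v set \<Rightarrow> 'w set \<Rightarrow> ('v \<Rightarrow> 'w) \<Rightarrow> bool" where
  "linear_iso_on s t V W f \<longleftrightarrow> linear_on s t V W f \<and> bij_betw f V W"

definition basis_of :: "('k::field \<Rightarrow> 'v::ab_group_add \<Rightarrow> 'v) \<Rightarrow> 'v set \<Rightarrow> 'v set \<Rightarrow> bool" where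
  "basis_of s V B \<longleftrightarrow> \<not> module.dependent s B \<and> module.span s B = V"

definition isomorphic_to_field :: "('k::field \<Rightarrow> 'v::ab_group_add \<Rightarrow> 'v) \<Rightarrow> 'v set \<Rightarrow> bool" where
  "isomorphic_to_field s V \<longleftrightarrow> (\<exists>f. linear_iso_on s ((*) :: 'k \<Rightarrow> 'k \<Rightarrow> 'k) V UNIV f)"

record ('p, 'v) pers_mod =
  pm_space :: "'p \<Rightarrow> 'v set"
  pm_map :: "'p \<Rightarrow> 'p \<Rightarrow> 'v \<Rightarrow> 'v"

definition persistence_module ::
    "('k::field \<Rightarrow> 'v::ab_group_add \<Rightarrow> 'v) \<Rightarrow> ('p::order, 'v) pers_mod \<Rightarrow> bool" where
  "persistence_module s M \<longleftrightarrow>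
     vector_space s \<and>
     (\<forall>q. module.subspace s (pm_space M q) \<and>
          (\<exists>A. finite A \<and> module.span s A = pm_space M q)) \<and>
     (\<forall>q p. q \<le> p \<longrightarrow> linear_on s s (pm_space M q) (pm_space M p) (pm_map M q p)) \<and>
     (\<forall>q. \<forall>x\<in>pm_space M q. pm_map M q q x = x) \<and>
     (\<forall>q p r. q \<le> p \<longrightarrow> p \<le> r \<longrightarrow>
        (\<forall>x\<in>pm_space M q. pm_map M q r x = pm_map M p r (pm_map M q p x)))"

definition nonzero_module :: "('p::order, 'v::ab_group_add) pers_mod \<Rightarrow> bool" where
  "nonzero_module M \<longleftrightarrow> (\<exists>q. pm_space M q \<noteq> {0})"

text \<open>
  The direct sum is a persistence module with respect to the scalar multiplication
  \<open>module_prod.scale s t\<close> on the product type.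
\<close>

definition direct_sum ::
    "('p::order, 'v::ab_group_add) pers_mod \<Rightarrow> ('p, 'w::ab_group_add) pers_mod \<Rightarrow>
     ('p, 'v \<times> 'w) pers_mod" where
  "direct_sum M N =
     \<lparr>pm_space = \<lambda>q. pm_space M q \<times> pm_space N q,
      pm_map = \<lambda>q p. map_prod (pm_map M q p) (pm_map N q p)\<rparr>"

definition pm_isomorphic ::
    "('k::field \<Rightarrow> 'v::ab_group_add \<Rightarrow> 'v) \<Rightarrow> ('k \<Rightarrow> 'w::ab_group_add \<Rightarrow> 'w) \<Rightarrow>
     ('p::order, 'v) pers_mod \<Rightarrow> ('p, 'w) pers_mod \<Rightarrow> bool" where
  "pm_isomorphic s t M N \<longleftrightarrow>
     (\<exists>\<phi>. (\<forall>q. linear_iso_on s t (pm_space M q) (pm_space N q) (\<phi> q)) \<and>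
          (\<forall>q p. q \<le> p \<longrightarrow>
             (\<forall>x\<in>pm_space M q. \<phi> p (pm_map M q p x) = pm_map N q p (\<phi> q x))))"

text \<open>
  The entry in row \<open>b'\<close> and column \<open>b\<close> of the matrix of the map from \<open>q\<close> to \<open>p\<close>, with rows and
  columns indexed by the bases \<open>B p\<close> and \<open>B q\<close> themselves.
\<close>

definition matrix_entry ::
    "('k::field \<Rightarrow> 'v::ab_group_add \<Rightarrow> 'v) \<Rightarrow> ('p::order, 'v) pers_mod \<Rightarrow> ('p \<Rightarrow> 'v set) \<Rightarrow>
     'p \<Rightarrow> 'p \<Rightarrow> 'v \<Rightarrow> 'v \<Rightarrow> 'k" where
  "matrix_entry s M B q p b' b = module.representation s (B p) (pm_map M q p b) b'"

definition component_basis ::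
    "('k::field \<Rightarrow> 'v::ab_group_add \<Rightarrow> 'v) \<Rightarrow> ('p::order, 'v) pers_mod \<Rightarrow> ('p \<Rightarrow> 'v set) \<Rightarrow> bool"
  where
  "component_basis s M B \<longleftrightarrow>
     (\<forall>q. basis_of s (pm_space M q) (B q)) \<and>
     (\<forall>q p. q \<le> p \<longrightarrow> (\<forall>b\<in>B q.
        (\<forall>b'\<in>B p. matrix_entry s M B q p b' b \<in> {0, 1}) \<and>
        (\<exists>!b'. b' \<in> B p \<and> matrix_entry s M B q p b' b = 1)))"

definition semi_component_basis ::
    "('k::field \<Rightarrow> 'v::ab_group_add \<Rightarrow> 'v) \<Rightarrow> ('p::order, 'v) pers_mod \<Rightarrow> ('p \<Rightarrow> 'v set) \<Rightarrow> bool"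
  where
  "semi_component_basis s M B \<longleftrightarrow>
     (\<forall>q. basis_of s (pm_space M q) (B q)) \<and>
     (\<forall>q p. q \<le> p \<longrightarrow> (\<forall>b\<in>B q.
        (\<forall>b'\<in>B p. matrix_entry s M B q p b' b \<in> {0, 1}) \<and>
        (\<exists>\<^sub>\<le>\<^sub>1 b'. b' \<in> B p \<and> matrix_entry s M B q p b' b = 1)))"

definition component_module ::
    "('k::field \<Rightarrow> 'v::ab_group_add \<Rightarrow> 'v) \<Rightarrow> ('p::order, 'v) pers_mod \<Rightarrow> bool" where
  "component_module s M \<longleftrightarrow> persistence_module s M \<and> (\<exists>B. component_basis s M B)"

definition semi_component_module ::
    "('k::field \<Rightarrow> 'v::ab_group_add \<Rightarrow> 'v) \<Rightarrow> ('p::order, 'v) pers_mod \<Rightarrow> bool" where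
  "semi_component_module s M \<longleftrightarrow> persistence_module s M \<and> (\<exists>B. semi_component_basis s M B)"

text \<open>
  A generator is a pair of an index and a vector: the spaces at different indices may share
  vectors of the ambient space.
\<close>

definition generators ::
    "('p::order, 'v) pers_mod \<Rightarrow> ('p \<Rightarrow> 'v set) \<Rightarrow> ('p \<times> 'v) set" where
  "generators M B =
     {(q, b). b \<in> B q \<and> (\<forall>p. p < q \<longrightarrow> b \<notin> pm_map M p q ` pm_space M p)}"

definition minimal_generator ::
    "('p::order, 'v) pers_mod \<Rightarrow> ('p \<Rightarrow> 'v set) \<Rightarrow> 'p \<times> 'v \<Rightarrow> bool" where
  "minimal_generator M B g \<longleftrightarrow>
     g \<in> generators M B \<and> (\<forall>h\<in>generators M B. fst g \<le> fst h)"

text \<open>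
  As in the usual list of axioms, this alone does not exclude the zero module. In the second
  axiom, the chosen basis of the one-dimensional space at \<open>p\<close> consists of the vector \<open>e p\<close>, and
  the matrix of a map is the identity iff it carries \<open>e q\<close> to \<open>e p\<close>.
\<close>

definition interval_module ::
    "('k::field \<Rightarrow> 'v::ab_group_add \<Rightarrow> 'v) \<Rightarrow> ('p::order, 'v) pers_mod \<Rightarrow> bool" where
  "interval_module s M \<longleftrightarrow>
     persistence_module s M \<and>
     (\<forall>p. isomorphic_to_field s (pm_space M p) \<or> pm_space M p = {0}) \<and>
     (\<exists>e. (\<forall>p. isomorphic_to_field s (pm_space M p) \<longrightarrow> basis_of s (pm_space M p) {e p}) \<and>
          (\<forall>q p. q \<le> p \<longrightarrow> isomorphic_to_field s (pm_space M q) \<longrightarrow>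
             isomorphic_to_field s (pm_space M p) \<longrightarrow> pm_map M q p (e q) = e p)) \<and>
     (\<forall>q p l. q \<le> p \<longrightarrow> p \<le> l \<longrightarrow> isomorphic_to_field s (pm_space M q) \<longrightarrow>
        isomorphic_to_field s (pm_space M l) \<longrightarrow> isomorphic_to_field s (pm_space M p))"

end

theory Submission
  imports Defs
begin

text \<open>
  In a component basis every map of the module carries basis vectors to basis vectors, so \<open>C\<close> is
  the linearisation of a functor from the poset to finite sets. Sending every basis vector to \<open>1\<close>
  therefore defines an augmentation \<open>\<epsilon>\<close> of \<open>C\<close> that commutes with all maps
  (\<open>component_basis_augmentation\<close>).

  Let \<open>b\<^sub>0\<close> at \<open>p\<^sub>0\<close> be a minimal generator. Every nonzero space of \<open>C\<close> has a generator below it,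
  hence lies above \<open>p\<^sub>0\<close> (\<open>minimal_generator_le\<close>). So \<open>C\<close> lives on the up-set of \<open>p\<^sub>0\<close>, where the
  image \<open>e q\<close> of \<open>b\<^sub>0\<close> is a basis vector that moves along with the maps of \<open>C\<close>. Consequently
  \<open>x \<mapsto> \<epsilon>(x) e q\<close> is an idempotent endomorphism of \<open>C\<close>, and an idempotent endomorphism splits the
  module into its image and its kernel (\<open>idempotent_splitting\<close>).

  The image is spanned by the vectors \<open>e q\<close>, so it is the interval module on the up-set of \<open>p\<^sub>0\<close>.
  The kernel is the kernel of the augmentation, with the differences \<open>b - e q\<close> as its basis, where
  \<open>b\<close> ranges over the other basis vectors at \<open>q\<close>. A map of \<open>C\<close> takes \<open>b - e q\<close> to \<open>b' - e p\<close>, where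
  \<open>b'\<close> is the image of \<open>b\<close>: this is again a basis vector, or zero if \<open>b' = e p\<close>. So the kernel is a
  semi-component module, and in general no more than that. A second generator \<open>(q, b)\<close> cannot
  coincide with \<open>(q, e q)\<close>, so it provides the nonzero vector \<open>b - e q\<close> of the kernel.
\<close>

section \<open>Submodules and idempotent endomorphisms\<close>

lemma
  assumes "persistence_module s M"
  shows persistence_module_vector_space: "vector_space s"
    and persistence_module_subspace: "module.subspace s (pm_space M q)"
    and persistence_module_finite_span: "\<exists>A. finite A \<and> module.span s A = pm_space M q"
    and persistence_module_linear:
      "q \<le> p \<Longrightarrow> linear_on s s (pm_space M q) (pm_space M p) (pm_map M q p)"
    and persistence_module_id: "x \<in> pm_space M q \<Longrightarrow> pm_map M q q x = x"
    and persistence_module_comp: "q \<le> p \<Longrightarrow> p \<le> r \<Longrightarrow> x \<in> pm_space M q \<Longrightarrow>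
      pm_map M q r x = pm_map M p r (pm_map M q p x)"
proof -
  note axioms = assms[unfolded persistence_module_def]
  note axioms' = conjunct2[OF axioms]
  show "vector_space s"
    using axioms by (rule conjunct1)
  show "module.subspace s (pm_space M q)"
    using conjunct1[OF axioms'] by (rule allE) (rule conjunct1)
  show "\<exists>A. finite A \<and> module.span s A = pm_space M q"
    using conjunct1[OF axioms'] by (rule allE) (rule conjunct2)
  note axioms'' = conjunct2[OF axioms']
  show "q \<le> p \<Longrightarrow> linear_on s s (pm_space M q) (pm_space M p) (pm_map M q p)"
    by (rule conjunct1[OF axioms'', rule_format])
  show "x \<in> pm_space M q \<Longrightarrow> pm_map M q q x = x"
    by (rule conjunct1[OF conjunct2[OF axioms''], rule_format])
  show "q \<le> p \<Longrightarrow> p \<le> r \<Longrightarrow> x \<in> pm_space M q \<Longrightarrow>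
      pm_map M q r x = pm_map M p r (pm_map M q p x)"
    by (rule conjunct2[OF conjunct2[OF axioms''], rule_format])
qed

definition restrict_module ::
    "('p::order, 'v::ab_group_add) pers_mod \<Rightarrow> ('p \<Rightarrow> 'v set) \<Rightarrow> ('p, 'v) pers_mod" where
  "restrict_module M U = \<lparr>pm_space = U, pm_map = pm_map M\<rparr>"

lemma restrict_module_simps [simp]:
  "pm_space (restrict_module M U) = U"
  "pm_map (restrict_module M U) = pm_map M"
  by (simp_all add: restrict_module_def)

lemma persistence_module_restrict:
  assumes M: "persistence_module s M"
    and subspace: "\<And>q. module.subspace s (U q)"
    and sub: "\<And>q. U q \<subseteq> pm_space M q"
    and closed: "\<And>q p x. q \<le> p \<Longrightarrow> x \<in> U q \<Longrightarrow> pm_map M q p x \<in> U p"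
  shows "persistence_module s (restrict_module M U)"
proof -
  interpret vs: vector_space s
    using M by (rule persistence_module_vector_space)
  have fin: "\<exists>A. finite A \<and> vs.span A = U q" for q
  proof -
    obtain A where A: "finite A" "vs.span A = pm_space M q"
      using persistence_module_finite_span[OF M] by blast
    obtain D where D: "D \<subseteq> U q" "vs.independent D" "U q \<subseteq> vs.span D"
      by (rule vs.maximal_independent_subset)
    have "finite D"
      using vs.independent_span_bound[OF A(1) D(2)] A(2) D(1) sub[of q] by simp
    moreover have "vs.span D = U q"
      using D(3) vs.span_minimal[OF D(1) subspace] by (rule equalityI[rotated])
    ultimately show ?thesis
      by blast
  qed
  have lin: "linear_on s s (U q) (U p) (pm_map M q p)" if "q \<le> p" for q p
  proof -
    have "linear_on s s (pm_space M q) (pm_space M p) (pm_map M q p)"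
      using M that by (rule persistence_module_linear)
    then show ?thesis
      using sub[of q] closed[OF that] unfolding linear_on_def by blast
  qed
  have id: "pm_map M q q x = x" if "x \<in> U q" for q x
    using persistence_module_id[OF M] that sub by blast
  have comp: "pm_map M q r x = pm_map M p r (pm_map M q p x)"
    if "q \<le> p" "p \<le> r" "x \<in> U q" for q p r x
    using persistence_module_comp[OF M] that sub by blast
  show ?thesis
    unfolding persistence_module_def restrict_module_simps
    by (intro conjI allI impI ballI;
        rule vs.vector_space_axioms subspace fin lin id comp; assumption)
qed

text \<open>
  The two components of \<open>x\<close> are \<open>\<rho> x\<close> and \<open>x - \<rho> x\<close>; addition recovers \<open>x\<close> from them.
\<close>

lemma idempotent_splitting:
  assumes M: "persistence_module s M"
    and lin: "\<And>q. linear_on s s (pm_space M q) (pm_space M q) (\<rho> q)"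
    and idem: "\<And>q x. x \<in> pm_space M q \<Longrightarrow> \<rho> q (\<rho> q x) = \<rho> q x"
    and nat: "\<And>q p x. q \<le> p \<Longrightarrow> x \<in> pm_space M q \<Longrightarrow>
                \<rho> p (pm_map M q p x) = pm_map M q p (\<rho> q x)"
  defines "I \<equiv> restrict_module M (\<lambda>q. \<rho> q ` pm_space M q)"
    and "K \<equiv> restrict_module M (\<lambda>q. {x \<in> pm_space M q. \<rho> q x = 0})"
  shows "persistence_module s I" and "persistence_module s K"
    and "pm_isomorphic s (module_prod.scale s s) M (direct_sum I K)"
proof -
  interpret vs: vector_space s
    using M by (rule persistence_module_vector_space)
  interpret vp: vector_space_prod s s ..
  have sp: "vs.subspace (pm_space M q)" for q
    using M by (rule persistence_module_subspace)
  have mp: "linear_on s s (pm_space M q) (pm_space M p) (pm_map M q p)" if "q \<le> p" for q p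
    using M that by (rule persistence_module_linear)
  have r_in: "\<rho> q x \<in> pm_space M q" if "x \<in> pm_space M q" for q x
    using lin that by (simp add: linear_on_def)
  have r_add: "\<rho> q (x + y) = \<rho> q x + \<rho> q y"
    if "x \<in> pm_space M q" "y \<in> pm_space M q" for q x y
    using lin that by (simp add: linear_on_def)
  have r_scale: "\<rho> q (s c x) = s c (\<rho> q x)" if "x \<in> pm_space M q" for q c x
    using lin that by (simp add: linear_on_def)
  have r_0: "\<rho> q 0 = 0" for q
    using r_scale[of 0 q 0] vs.subspace_0[OF sp] by simp
  have r_diff: "\<rho> q (x - y) = \<rho> q x - \<rho> q y"
    if "x \<in> pm_space M q" "y \<in> pm_space M q" for q x y
    using r_add[of "x - y" q y] that vs.subspace_diff[OF sp] by simp
  have m_in: "pm_map M q p x \<in> pm_space M p" if "q \<le> p" "x \<in> pm_space M q" for q p x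
    using mp that by (simp add: linear_on_def)
  have m_0: "pm_map M q p 0 = 0" if "q \<le> p" for q p
  proof -
    have "pm_map M q p (s 0 0) = s 0 (pm_map M q p 0)"
      using mp[OF that] vs.subspace_0[OF sp] unfolding linear_on_def by blast
    then show ?thesis by simp
  qed
  have m_diff: "pm_map M q p (x - y) = pm_map M q p x - pm_map M q p y"
    if "q \<le> p" "x \<in> pm_space M q" "y \<in> pm_space M q" for q p x y
  proof -
    have "pm_map M q p ((x - y) + y) = pm_map M q p (x - y) + pm_map M q p y"
      using mp[OF that(1)] that vs.subspace_diff[OF sp] unfolding linear_on_def by blast
    then show ?thesis by simp
  qed
  have imI: "vs.subspace (\<rho> q ` pm_space M q)" for q
  proof (rule vs.subspaceI)
    show "0 \<in> \<rho> q ` pm_space M q"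
      using r_0 vs.subspace_0[OF sp] by (intro image_eqI[of _ _ 0]) simp_all
  next
    fix x y assume "x \<in> \<rho> q ` pm_space M q" "y \<in> \<rho> q ` pm_space M q"
    then obtain u v where "x = \<rho> q u" "y = \<rho> q v" "u \<in> pm_space M q" "v \<in> pm_space M q"
      by blast
    then show "x + y \<in> \<rho> q ` pm_space M q"
      using r_add vs.subspace_add[OF sp] by (intro image_eqI[of _ _ "u + v"]) simp_all
  next
    fix c x assume "x \<in> \<rho> q ` pm_space M q"
    then obtain u where "x = \<rho> q u" "u \<in> pm_space M q"
      by blast
    then show "s c x \<in> \<rho> q ` pm_space M q"
      using r_scale vs.subspace_scale[OF sp] by (intro image_eqI[of _ _ "s c u"]) simp_all
  qed
  have kerI: "vs.subspace {x \<in> pm_space M q. \<rho> q x = 0}" for q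
    using vs.subspace_0[OF sp] vs.subspace_add[OF sp] vs.subspace_scale[OF sp]
    by (intro vs.subspaceI) (auto simp: r_0 r_add r_scale)
  show "persistence_module s I"
    unfolding I_def
  proof (rule persistence_module_restrict[OF M imI])
    show "\<rho> q ` pm_space M q \<subseteq> pm_space M q" for q
      using r_in by blast
    fix q p x assume "q \<le> p" "x \<in> \<rho> q ` pm_space M q"
    then obtain u where "x = \<rho> q u" "u \<in> pm_space M q"
      by blast
    then show "pm_map M q p x \<in> \<rho> p ` pm_space M p"
      using nat m_in \<open>q \<le> p\<close> by (intro image_eqI[of _ _ "pm_map M q p u"]) simp_all
  qed
  show "persistence_module s K"
    unfolding K_def
  proof (rule persistence_module_restrict[OF M kerI])
    show "pm_map M q p x \<in> {x \<in> pm_space M p. \<rho> p x = 0}"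
      if "q \<le> p" "x \<in> {x \<in> pm_space M q. \<rho> q x = 0}" for q p x
      using that m_in nat m_0 by simp
  qed blast
  have "linear_iso_on s (module_prod.scale s s) (pm_space M q) (pm_space (direct_sum I K) q)
          (\<lambda>x. (\<rho> q x, x - \<rho> q x))" for q
    unfolding linear_iso_on_def
  proof
    have component: "(\<rho> q x, x - \<rho> q x) \<in> pm_space (direct_sum I K) q"
      if "x \<in> pm_space M q" for x
      using that r_in[OF that] vs.subspace_diff[OF sp that r_in[OF that]]
        r_diff[OF that r_in[OF that]] idem[OF that]
      by (simp add: direct_sum_def I_def K_def)
    show "linear_on s (module_prod.scale s s) (pm_space M q) (pm_space (direct_sum I K) q)
            (\<lambda>x. (\<rho> q x, x - \<rho> q x))"
      using component
      by (simp add: linear_on_def r_add r_scale vp.scale_prod vs.scale_right_diff_distrib)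
    show "bij_betw (\<lambda>x. (\<rho> q x, x - \<rho> q x)) (pm_space M q) (pm_space (direct_sum I K) q)"
    proof (rule bij_betw_byWitness[where f' = "\<lambda>(u, v). u + v"])
      show "(\<lambda>x. (\<rho> q x, x - \<rho> q x)) ` pm_space M q \<subseteq> pm_space (direct_sum I K) q"
        using component by blast
      show "(\<lambda>(u, v). u + v) ` pm_space (direct_sum I K) q \<subseteq> pm_space M q"
        by (auto simp: direct_sum_def I_def K_def intro!: vs.subspace_add[OF sp] r_in)
      show "\<forall>x\<in>pm_space M q. (case (\<rho> q x, x - \<rho> q x) of (u, v) \<Rightarrow> u + v) = x"
        by simp
      show "\<forall>y\<in>pm_space (direct_sum I K) q.
          (\<rho> q (case y of (u, v) \<Rightarrow> u + v),
            (case y of (u, v) \<Rightarrow> u + v) - \<rho> q (case y of (u, v) \<Rightarrow> u + v)) = y"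
        by (auto simp: direct_sum_def I_def K_def r_add r_in idem)
    qed
  qed
  moreover have "(\<rho> p (pm_map M q p x), pm_map M q p x - \<rho> p (pm_map M q p x)) =
      pm_map (direct_sum I K) q p (\<rho> q x, x - \<rho> q x)"
    if "q \<le> p" "x \<in> pm_space M q" for q p x
    using that by (simp add: direct_sum_def I_def K_def nat m_diff r_in)
  ultimately show "pm_isomorphic s (module_prod.scale s s) M (direct_sum I K)"
    unfolding pm_isomorphic_def by (intro exI[of _ "\<lambda>q x. (\<rho> q x, x - \<rho> q x)"]) simp
qed

section \<open>Interval modules\<close>

lemma vector_space_field: "vector_space ((*) :: 'k::field \<Rightarrow> 'k \<Rightarrow> 'k)"
  by unfold_locales (simp_all add: algebra_simps)

lemma isomorphic_to_field_span_singleton: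
  fixes s :: "'k::field \<Rightarrow> 'v::ab_group_add \<Rightarrow> 'v"
  assumes "vector_space s" and "e \<noteq> 0"
  shows "isomorphic_to_field s (module.span s {e})"
proof -
  interpret vs: vector_space s by fact
  interpret vf: vector_space "(*) :: 'k \<Rightarrow> 'k \<Rightarrow> 'k" by (rule vector_space_field)
  interpret vpair: vector_space_pair s "(*) :: 'k \<Rightarrow> 'k \<Rightarrow> 'k" ..
  have "vs.independent {e}"
    using assms(2) by simp
  from vpair.linear_independent_extend[OF this, of "\<lambda>_. 1"]
  obtain f where f: "Vector_Spaces.linear s (*) f" "f e = 1"
    by auto
  have "bij_betw f (vs.span {e}) UNIV"
    by (rule bij_betw_byWitness[where f' = "\<lambda>c. s c e"])
      (auto simp: vs.span_singleton vpair.linear_scale[OF f(1)] f(2))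
  then show ?thesis
    unfolding isomorphic_to_field_def linear_iso_on_def linear_on_def
    by (intro exI[of _ f]) (simp add: vpair.linear_add[OF f(1)] vpair.linear_scale[OF f(1)])
qed

lemma not_isomorphic_to_field_zero:
  assumes "vector_space s"
  shows "\<not> isomorphic_to_field s {0}"
proof
  interpret vs: vector_space s by fact
  assume "isomorphic_to_field s {0}"
  then obtain f where f: "linear_on s (*) {0} UNIV f" "f ` {0} = UNIV"
    unfolding isomorphic_to_field_def linear_iso_on_def bij_betw_def by blast
  have "f (s 0 0) = 0 * f 0"
    using f(1) unfolding linear_on_def by blast
  then have "f 0 = 0" by simp
  with f(2) have "1 \<in> {0 :: 'a}"
    by (metis UNIV_I image_empty image_insert)
  then show False by simp
qed

text \<open>
  It is enough to exhibit the support \<open>J\<close>, which has to be convex, and compatible nonzero vectors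
  on it, because the dimension of a space decides whether its index belongs to \<open>J\<close>.
\<close>

lemma interval_moduleI:
  assumes M: "persistence_module s M"
    and space: "\<And>q. pm_space M q = (if q \<in> J then module.span s {e q} else {0})"
    and nonzero: "\<And>q. q \<in> J \<Longrightarrow> e q \<noteq> 0"
    and map: "\<And>q p. q \<le> p \<Longrightarrow> q \<in> J \<Longrightarrow> p \<in> J \<Longrightarrow> pm_map M q p (e q) = e p"
    and convex: "\<And>q p l. q \<le> p \<Longrightarrow> p \<le> l \<Longrightarrow> q \<in> J \<Longrightarrow> l \<in> J \<Longrightarrow> p \<in> J"
  shows "interval_module s M"
proof -
  have vs: "vector_space s"
    using M by (rule persistence_module_vector_space)
  then interpret vs: vector_space s .
  have iso: "isomorphic_to_field s (pm_space M q) \<longleftrightarrow> q \<in> J" for q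
    using space[of q] isomorphic_to_field_span_singleton[OF vs nonzero]
      not_isomorphic_to_field_zero[OF vs] by auto
  have "basis_of s (pm_space M q) {e q}" if "q \<in> J" for q
    using that nonzero space by (simp add: basis_of_def)
  then show ?thesis
    unfolding interval_module_def iso using M space map convex by auto
qed

section \<open>The augmentation of a component module\<close>

text \<open>
  A \<open>0\<close>-\<open>1\<close> column with a single \<open>1\<close> is the coordinate vector of a basis vector.
\<close>

lemma component_basis_map:
  assumes M: "persistence_module s M" and B: "component_basis s M B"
    and "q \<le> p" and "b \<in> B q"
  shows "pm_map M q p b \<in> B p"
proof -
  interpret vs: vector_space s
    using M by (rule persistence_module_vector_space)
  let ?r = "vs.representation (B p) (pm_map M q p b)"
  have ind: "vs.independent (B p)" and span: "vs.span (B p) = pm_space M p"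
    and spanq: "vs.span (B q) = pm_space M q"
    using B by (auto simp: component_basis_def basis_of_def)
  have "b \<in> pm_space M q"
    using \<open>b \<in> B q\<close> vs.span_base spanq by blast
  moreover have "linear_on s s (pm_space M q) (pm_space M p) (pm_map M q p)"
    using M \<open>q \<le> p\<close> by (rule persistence_module_linear)
  ultimately have x: "pm_map M q p b \<in> vs.span (B p)"
    using span by (simp add: linear_on_def)
  have entries: "\<forall>b'\<in>B p. ?r b' \<in> {0, 1}" and unique: "\<exists>!b'. b' \<in> B p \<and> ?r b' = 1"
    using B \<open>q \<le> p\<close> \<open>b \<in> B q\<close> unfolding component_basis_def matrix_entry_def by blast+
  from unique obtain c where c: "c \<in> B p" "?r c = 1"
    and c_unique: "\<And>b'. b' \<in> B p \<Longrightarrow> ?r b' = 1 \<Longrightarrow> b' = c"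
    by blast
  have "v = c" if "?r v \<noteq> 0" for v
    using that entries c_unique vs.representation_ne_zero by blast
  then have "{v. ?r v \<noteq> 0} = {c}"
    using c(2) by force
  then have "pm_map M q p b = c"
    using vs.sum_nonzero_representation_eq[OF ind x] c(2) by simp
  then show ?thesis
    using c(1) by simp
qed

text \<open>
  Each map of the module turns a linear combination of basis vectors into one with the same sum of
  coefficients; this sum is the augmentation.
\<close>

lemma component_basis_augmentation:
  fixes s :: "'k::field \<Rightarrow> 'v::ab_group_add \<Rightarrow> 'v"
  assumes M: "persistence_module s M" and B: "component_basis s M B"
  obtains \<epsilon> where "\<And>q. Vector_Spaces.linear s (*) (\<epsilon> q)"
    and "\<And>q b. b \<in> B q \<Longrightarrow> \<epsilon> q b = 1"
    and "\<And>q p x. q \<le> p \<Longrightarrow> x \<in> pm_space M q \<Longrightarrow> \<epsilon> p (pm_map M q p x) = \<epsilon> q x"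
proof -
  interpret vs: vector_space s
    using M by (rule persistence_module_vector_space)
  interpret vf: vector_space "(*) :: 'k \<Rightarrow> 'k \<Rightarrow> 'k" by (rule vector_space_field)
  interpret vpair: vector_space_pair s "(*) :: 'k \<Rightarrow> 'k \<Rightarrow> 'k" ..
  have ind: "vs.independent (B q)" and span: "vs.span (B q) = pm_space M q" for q
    using B by (auto simp: component_basis_def basis_of_def)
  have "\<forall>q. \<exists>g. Vector_Spaces.linear s (*) g \<and> (\<forall>b\<in>B q. g b = 1)"
    using vpair.linear_independent_extend[OF ind, of _ "\<lambda>_. 1"] by blast
  then obtain \<epsilon> where lin: "\<And>q. Vector_Spaces.linear s (*) (\<epsilon> q)"
    and one: "\<And>q b. b \<in> B q \<Longrightarrow> \<epsilon> q b = 1"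
    by metis
  have "\<epsilon> p (pm_map M q p x) = \<epsilon> q x" if "q \<le> p" "x \<in> pm_space M q" for q p x
  proof -
    have m: "linear_on s s (pm_space M q) (pm_space M p) (pm_map M q p)"
      using M \<open>q \<le> p\<close> by (rule persistence_module_linear)
    have sp: "vs.subspace (pm_space M q)"
      using M by (rule persistence_module_subspace)
    have "pm_map M q p (s 0 0) = s 0 (pm_map M q p 0)"
      using m vs.subspace_0[OF sp] unfolding linear_on_def by blast
    then have m0: "pm_map M q p 0 = 0"
      by simp
    let ?E = "{x \<in> pm_space M q. \<epsilon> p (pm_map M q p x) = \<epsilon> q x}"
    have "vs.subspace ?E"
      using m vs.subspace_0[OF sp] vs.subspace_add[OF sp] vs.subspace_scale[OF sp] m0
      by (intro vs.subspaceI)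
        (auto simp: linear_on_def vpair.linear_0[OF lin] vpair.linear_add[OF lin]
          vpair.linear_scale[OF lin])
    moreover have "B q \<subseteq> ?E"
      using one component_basis_map[OF M B \<open>q \<le> p\<close>] vs.span_base span by fastforce
    ultimately have "vs.span (B q) \<subseteq> ?E"
      by (rule vs.span_minimal[rotated])
    then show ?thesis
      using that span by blast
  qed
  with lin one show thesis
    by (rule that)
qed

text \<open>
  The map \<open>x \<mapsto> x - \<epsilon>(x) e\<close> projects the space onto the kernel of \<open>\<epsilon>\<close> along \<open>e\<close>. It takes the
  basis vector \<open>b\<close> to \<open>b - e\<close>, and is injective on the span of the basis vectors other than \<open>e\<close>.
\<close>

lemma basis_of_augmentation_kernel:
  fixes s :: "'k::field \<Rightarrow> 'v::ab_group_add \<Rightarrow> 'v"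
  assumes "vector_space s" and ind: "\<not> module.dependent s B" and e: "e \<in> B"
    and lin: "Vector_Spaces.linear s (*) \<epsilon>" and one: "\<And>b. b \<in> B \<Longrightarrow> \<epsilon> b = 1"
  shows "basis_of s {x \<in> module.span s B. \<epsilon> x = 0} ((\<lambda>b. b - e) ` (B - {e}))"
proof -
  interpret vs: vector_space s by fact
  interpret vf: vector_space "(*) :: 'k \<Rightarrow> 'k \<Rightarrow> 'k" by (rule vector_space_field)
  interpret vpair: vector_space_pair s "(*) :: 'k \<Rightarrow> 'k \<Rightarrow> 'k" ..
  interpret vself: vector_space_pair s s ..
  define f where "f x = x - s (\<epsilon> x) e" for x
  have linf: "Vector_Spaces.linear s s f"
    by unfold_locales
      (simp_all add: f_def vpair.linear_add[OF lin] vpair.linear_scale[OF lin]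
        vs.scale_left_distrib vs.scale_right_diff_distrib)
  have fB: "f b = b - e" if "b \<in> B" for b
    using that by (simp add: f_def one)
  have img: "f ` (B - {e}) = (\<lambda>b. b - e) ` (B - {e})"
    by (intro image_cong) (auto simp: fB)
  have "inj_on f (vs.span (B - {e}))"
    unfolding vself.linear_inj_on_iff_eq_0[OF linf vs.subspace_span]
  proof (intro ballI impI)
    fix x assume x: "x \<in> vs.span (B - {e})" and "f x = 0"
    then have eq: "x = s (\<epsilon> x) e"
      by (simp add: f_def)
    have "\<epsilon> x = 0"
    proof (rule ccontr)
      assume "\<epsilon> x \<noteq> 0"
      then have "e = s (inverse (\<epsilon> x)) x"
        by (subst eq) simp
      then have "e \<in> vs.span (B - {e})"
        using vs.span_scale[OF x] by metis
      then show False
        using ind e by (auto simp: vs.dependent_def)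
    qed
    with eq show "x = 0" by simp
  qed
  then have "vs.independent (f ` (B - {e}))"
    using vself.linear_independent_injective_image[OF linf] vs.independent_mono[OF ind]
    by blast
  moreover have "vs.span (f ` (B - {e})) = {x \<in> vs.span B. \<epsilon> x = 0}"
  proof -
    have "f ` B = insert 0 (f ` (B - {e}))"
      using e fB[OF e] by auto
    then have "vs.span (f ` (B - {e})) = vs.span (f ` B)"
      by (simp add: vs.span_insert_0)
    also have "\<dots> = f ` vs.span B"
      by (rule vself.linear_span_image[OF linf])
    also have "\<dots> = {x \<in> vs.span B. \<epsilon> x = 0}"
    proof (intro equalityI subsetI)
      fix y assume "y \<in> f ` vs.span B"
      then show "y \<in> {x \<in> vs.span B. \<epsilon> x = 0}"
        using e vs.span_diff[OF _ vs.span_scale[OF vs.span_base[OF e]]]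
        by (auto simp: f_def vpair.linear_diff[OF lin] vpair.linear_scale[OF lin] one)
    next
      fix x assume "x \<in> {x \<in> vs.span B. \<epsilon> x = 0}"
      then show "x \<in> f ` vs.span B"
        by (intro image_eqI[of _ _ x]) (auto simp: f_def)
    qed
    finally show ?thesis .
  qed
  ultimately show ?thesis
    by (simp add: basis_of_def img)
qed

section \<open>Splitting off the component of a minimal generator\<close>

text \<open>
  Below \<open>q\<close> choose a minimal index whose space is nonzero. All spaces strictly below it vanish, so
  its basis vectors are generators.
\<close>

lemma minimal_generator_le:
  fixes M :: "('p::{finite, order}, 'v::ab_group_add) pers_mod"
  assumes M: "persistence_module s M" and B: "\<And>q. basis_of s (pm_space M q) (B q)"
    and g: "minimal_generator M B g" and "B q \<noteq> {}"
  shows "fst g \<le> q"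
proof -
  interpret vs: vector_space s
    using M by (rule persistence_module_vector_space)
  obtain r where r: "B r \<noteq> {}" "r \<le> q" and min: "\<And>p. B p \<noteq> {} \<Longrightarrow> p \<le> r \<Longrightarrow> r = p"
    using finite_has_minimal2[of "{r. B r \<noteq> {}}" q] \<open>B q \<noteq> {}\<close> by auto
  obtain b where b: "b \<in> B r"
    using r(1) by blast
  have "b \<noteq> 0"
    using B[of r] b vs.dependent_zero by (auto simp: basis_of_def)
  have "b \<notin> pm_map M p r ` pm_space M p" if "p < r" for p
  proof -
    have "B p = {}"
      using min[of p] that less_le by blast
    then have zero: "pm_space M p = {0}"
      using B[of p] by (auto simp: basis_of_def)
    have "pm_map M p r (s 0 0) = s 0 (pm_map M p r 0)"
      using M that zero unfolding persistence_module_def linear_on_def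
      by (metis less_imp_le singletonI)
    then show ?thesis
      using zero \<open>b \<noteq> 0\<close> by simp
  qed
  then have "(r, b) \<in> generators M B"
    using b by (simp add: generators_def)
  then have "fst g \<le> r"
    using g by (force simp: minimal_generator_def)
  with r(2) show ?thesis by simp
qed

text \<open>
  The map from \<open>q\<close> to \<open>p\<close> takes \<open>b - e q\<close> to \<open>b' - e p\<close> with \<open>b' \<in> B p\<close>. Its column has a single \<open>1\<close>
  if \<open>b' \<noteq> e p\<close>, and is zero if \<open>b'\<close> merges with the distinguished vector \<open>e p\<close>.
\<close>

lemma semi_component_basis_augmentation_kernel:
  fixes s :: "'k::field \<Rightarrow> 'v::ab_group_add \<Rightarrow> 'v"
  assumes M: "persistence_module s M" and B: "component_basis s M B"
    and lin: "\<And>q. Vector_Spaces.linear s (*) (\<epsilon> q)"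
    and one: "\<And>q b. b \<in> B q \<Longrightarrow> \<epsilon> q b = 1"
    and e: "\<And>q. B q \<noteq> {} \<Longrightarrow> e q \<in> B q"
    and map_e: "\<And>q p. q \<le> p \<Longrightarrow> B q \<noteq> {} \<Longrightarrow> pm_map M q p (e q) = e p"
  shows "semi_component_basis s (restrict_module M (\<lambda>q. {x \<in> pm_space M q. \<epsilon> q x = 0}))
           (\<lambda>q. (\<lambda>b. b - e q) ` (B q - {e q}))"
    (is "semi_component_basis s (restrict_module M ?K) ?D")
proof -
  have vs: "vector_space s"
    using M by (rule persistence_module_vector_space)
  then interpret vs: vector_space s .
  have ind: "vs.independent (B q)" and span: "vs.span (B q) = pm_space M q" for q
    using B by (auto simp: component_basis_def basis_of_def)
  have basis: "basis_of s (?K q) (?D q)" for q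
  proof (cases "B q = {}")
    case True
    have "vector_space ((*) :: 'k \<Rightarrow> 'k \<Rightarrow> 'k)"
      by (rule vector_space_field)
    then interpret vpair: vector_space_pair s "(*) :: 'k \<Rightarrow> 'k \<Rightarrow> 'k"
      using vs by (simp add: vector_space_pair_def)
    show ?thesis
      using True span[of q, symmetric] vpair.linear_0[OF lin[of q]] vs.independent_empty
      by (auto simp: basis_of_def)
  next
    case False
    then show ?thesis
      using basis_of_augmentation_kernel[OF vs ind e lin one] span by simp
  qed
  have "(\<forall>d'\<in>?D p. matrix_entry s (restrict_module M ?K) ?D q p d' d \<in> {0, 1}) \<and>
      (\<exists>\<^sub>\<le>\<^sub>1 d'. d' \<in> ?D p \<and> matrix_entry s (restrict_module M ?K) ?D q p d' d = 1)"
    if qp: "q \<le> p" and d: "d \<in> ?D q" for q p d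
  proof -
    have indD: "vs.independent (?D p)"
      using basis by (simp add: basis_of_def)
    obtain b where b: "b \<in> B q" "d = b - e q"
      using d by blast
    then have eq: "e q \<in> B q"
      using e by blast
    have "linear_on s s (pm_space M q) (pm_space M p) (pm_map M q p)"
      using M qp by (rule persistence_module_linear)
    moreover have "b - e q \<in> pm_space M q" "e q \<in> pm_space M q"
      unfolding span[symmetric] by (simp_all add: b eq vs.span_base vs.span_diff)
    ultimately have "pm_map M q p ((b - e q) + e q) = pm_map M q p (b - e q) + pm_map M q p (e q)"
      unfolding linear_on_def by blast
    moreover have "pm_map M q p (e q) = e p"
      using map_e[OF qp] b(1) by blast
    ultimately have image: "pm_map M q p d = pm_map M q p b - e p"
      by (simp add: b(2))
    show ?thesis
    proof (cases "pm_map M q p b = e p")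
      case True
      then have "vs.representation (?D p) (pm_map M q p d) = (\<lambda>_. 0)"
        by (simp add: image vs.representation_zero)
      then show ?thesis
        by (simp add: matrix_entry_def Uniq_def)
    next
      case False
      then have "pm_map M q p d \<in> ?D p"
        using component_basis_map[OF M B qp b(1)] by (simp add: image)
      then have "vs.representation (?D p) (pm_map M q p d) =
          (\<lambda>v. if v = pm_map M q p d then 1 else 0)"
        by (rule vs.representation_basis[OF indD])
      then show ?thesis
        by (auto simp: matrix_entry_def Uniq_def)
    qed
  qed
  then show ?thesis
    unfolding semi_component_basis_def using basis by simp
qed

theorem theorem5p3:
  fixes s :: "'k::field \<Rightarrow> 'v::ab_group_add \<Rightarrow> 'v"
    and C :: "('p::{finite, order}, 'v) pers_mod"
    and B :: "'p \<Rightarrow> 'v set"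
  assumes "component_module s C"
    and "component_basis s C B"
    and "card (generators C B) \<ge> 2"
    and "\<exists>g. minimal_generator C B g"
  shows "\<exists>(I :: ('p, 'v) pers_mod) (S :: ('p, 'v) pers_mod).
           interval_module s I \<and> nonzero_module I \<and>
           semi_component_module s S \<and> nonzero_module S \<and>
           pm_isomorphic s (module_prod.scale s s) C (direct_sum I S)"
proof -
  have M: "persistence_module s C"
    using assms(1) by (simp add: component_module_def)
  have vs: "vector_space s"
    using M by (rule persistence_module_vector_space)
  then interpret vs: vector_space s .
  interpret vf: vector_space "(*) :: 'k \<Rightarrow> 'k \<Rightarrow> 'k" by (rule vector_space_field)
  interpret vpair: vector_space_pair s "(*) :: 'k \<Rightarrow> 'k \<Rightarrow> 'k" ..
  note B = assms(2)
  have basis: "basis_of s (pm_space C q) (B q)" for q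
    using B by (simp add: component_basis_def)
  have ind: "vs.independent (B q)" and span: "vs.span (B q) = pm_space C q" for q
    using basis by (auto simp: basis_of_def)
  have base: "b \<in> pm_space C q" if "b \<in> B q" for q b
    using that vs.span_base span by blast
  have nz: "b \<noteq> 0" if "b \<in> B q" for q b
    using that ind[of q] vs.dependent_zero by blast
  obtain p0 b0 where g: "minimal_generator C B (p0, b0)"
    using assms(4) by auto
  then have b0: "b0 \<in> B p0"
    by (simp add: minimal_generator_def generators_def)
  have support: "p0 \<le> q" if "B q \<noteq> {}" for q
    using minimal_generator_le[OF M basis g that] by simp

  \<comment> \<open>Off the up-set of \<open>p0\<close> the value of \<open>e\<close> is meaningless. There the spaces vanish, so that
      \<open>\<rho>\<close> below is zero on them all the same.\<close>
  define e where "e q = pm_map C p0 q b0" for q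
  have e_in: "e q \<in> B q" if "p0 \<le> q" for q
    unfolding e_def using component_basis_map[OF M B that b0] .
  have e_map: "pm_map C q p (e q) = e p" if "p0 \<le> q" "q \<le> p" for q p
    unfolding e_def using persistence_module_comp[OF M that base[OF b0]] by (rule sym)

  obtain \<epsilon> where lin: "\<And>q. Vector_Spaces.linear s (*) (\<epsilon> q)"
    and one: "\<And>q b. b \<in> B q \<Longrightarrow> \<epsilon> q b = 1"
    and nat: "\<And>q p x. q \<le> p \<Longrightarrow> x \<in> pm_space C q \<Longrightarrow> \<epsilon> p (pm_map C q p x) = \<epsilon> q x"
    using component_basis_augmentation[OF M B] by blast
  have zero: "pm_space C q = {0}" if "\<not> p0 \<le> q" for q
  proof -
    have "B q = {}"
      using that support by blast
    then show ?thesis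
      using span[of q] by simp
  qed

  define \<rho> where "\<rho> q x = s (\<epsilon> q x) (e q)" for q x
  have rho_0: "\<rho> q 0 = 0" for q
    by (simp add: \<rho>_def vpair.linear_0[OF lin])
  have rho_in: "\<rho> q x \<in> pm_space C q" if "x \<in> pm_space C q" for q x
  proof (cases "p0 \<le> q")
    case True
    then show ?thesis
      unfolding \<rho>_def span[symmetric] by (simp add: e_in vs.span_scale vs.span_base)
  next
    case False
    then show ?thesis
      using that zero rho_0 by auto
  qed
  have rho_lin: "linear_on s s (pm_space C q) (pm_space C q) (\<rho> q)" for q
    using rho_in
    by (simp add: linear_on_def \<rho>_def vpair.linear_add[OF lin] vpair.linear_scale[OF lin]
        vs.scale_left_distrib)
  have rho_idem: "\<rho> q (\<rho> q x) = \<rho> q x" if "x \<in> pm_space C q" for q x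
  proof (cases "p0 \<le> q")
    case True
    then show ?thesis
      by (simp add: \<rho>_def vpair.linear_scale[OF lin] one[OF e_in])
  next
    case False
    then show ?thesis
      using that zero rho_0 by auto
  qed
  have rho_nat: "\<rho> p (pm_map C q p x) = pm_map C q p (\<rho> q x)"
    if qp: "q \<le> p" and x: "x \<in> pm_space C q" for q p x
  proof -
    have "linear_on s s (pm_space C q) (pm_space C p) (pm_map C q p)"
      using M qp by (rule persistence_module_linear)
    then have m: "pm_map C q p (s c y) = s c (pm_map C q p y)" if "y \<in> pm_space C q" for c y
      using that by (simp add: linear_on_def)
    show ?thesis
    proof (cases "p0 \<le> q")
      case True
      then show ?thesis
        using nat[OF qp x] m[OF base[OF e_in[OF True]]] e_map[OF True qp] by (simp add: \<rho>_def)
    next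
      case False
      then have "x = 0" "pm_map C q p 0 = 0"
        using x zero m[of 0 0] by auto
      then show ?thesis
        by (simp add: rho_0)
    qed
  qed

  define I where "I = restrict_module C (\<lambda>q. \<rho> q ` pm_space C q)"
  define S where "S = restrict_module C (\<lambda>q. {x \<in> pm_space C q. \<rho> q x = 0})"
  have I: "persistence_module s I" and S: "persistence_module s S"
    and iso: "pm_isomorphic s (module_prod.scale s s) C (direct_sum I S)"
    unfolding I_def S_def using idempotent_splitting[OF M rho_lin rho_idem rho_nat] by simp_all

  have space_I: "pm_space I q = (if q \<in> {p0..} then vs.span {e q} else {0})" for q
  proof (cases "p0 \<le> q")
    case True
    have "s c (e q) \<in> \<rho> q ` pm_space C q" for c
    proof (rule image_eqI[of _ _ "s c (e q)"])
      show "s c (e q) = \<rho> q (s c (e q))"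
        by (simp add: \<rho>_def vpair.linear_scale[OF lin] one[OF e_in[OF True]])
      show "s c (e q) \<in> pm_space C q"
        unfolding span[symmetric] by (simp add: e_in[OF True] vs.span_scale vs.span_base)
    qed
    then show ?thesis
      using True by (auto simp: I_def vs.span_singleton \<rho>_def)
  next
    case False
    then show ?thesis
      using zero by (simp add: I_def rho_0)
  qed
  have "interval_module s I"
  proof (rule interval_moduleI[OF I space_I])
    show "e q \<noteq> 0" if "q \<in> {p0..}" for q
      using that nz e_in by (metis atLeast_iff)
    show "pm_map I q p (e q) = e p" if "q \<le> p" "q \<in> {p0..}" for q p
      using that e_map by (simp add: I_def)
    show "p \<in> {p0..}" if "q \<le> p" "q \<in> {p0..}" for q p
      using that by auto
  qed
  moreover have "nonzero_module I"
  proof -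
    have "e p0 \<in> pm_space I p0"
      using space_I[of p0] vs.span_base by auto
    then show ?thesis
      using nz[OF e_in[OF order_refl]] by (auto simp: nonzero_module_def)
  qed
  moreover have "semi_component_module s S"
  proof -
    \<comment> \<open>The kernels of \<open>\<rho>\<close> and of \<open>\<epsilon>\<close> agree because \<open>e q\<close> is nonzero wherever the space is.\<close>
    have "{x \<in> pm_space C q. \<rho> q x = 0} = {x \<in> pm_space C q. \<epsilon> q x = 0}" for q
      using zero[of q] nz[OF e_in[of q]] rho_0[of q] vpair.linear_0[OF lin[of q]]
      by (cases "p0 \<le> q") (auto simp: \<rho>_def)
    then have "S = restrict_module C (\<lambda>q. {x \<in> pm_space C q. \<epsilon> q x = 0})"
      by (simp add: S_def)
    moreover have "e q \<in> B q" if "B q \<noteq> {}" for q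
      using that support e_in by blast
    moreover have "pm_map C q p (e q) = e p" if "q \<le> p" "B q \<noteq> {}" for q p
      using that support e_map by blast
    ultimately have "semi_component_basis s S (\<lambda>q. (\<lambda>b. b - e q) ` (B q - {e q}))"
      using semi_component_basis_augmentation_kernel[OF M B lin one] by simp
    then show ?thesis
      using S unfolding semi_component_module_def by blast
  qed
  moreover have "nonzero_module S"
  proof -
    have "\<not> generators C B \<subseteq> {(p0, b0)}"
    proof
      assume "generators C B \<subseteq> {(p0, b0)}"
      then have "card (generators C B) \<le> card {(p0, b0)}"
        by (intro card_mono) auto
      then show False
        using assms(3) by simp
    qed
    then obtain q b where h: "(q, b) \<in> generators C B" "(q, b) \<noteq> (p0, b0)"
      by auto
    then have b: "b \<in> B q"
      by (simp add: generators_def)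
    then have q: "p0 \<le> q"
      using support by blast
    have "b \<noteq> e q"
    proof (cases "q = p0")
      case True
      moreover have "e p0 = b0"
        unfolding e_def using base[OF b0] by (rule persistence_module_id[OF M])
      ultimately show ?thesis
        using h(2) by auto
    next
      case False
      then have "p0 < q"
        using q by simp
      then show ?thesis
        using h(1) base[OF b0] by (auto simp: generators_def e_def)
    qed
    moreover have "b - e q \<in> pm_space S q"
    proof -
      have "b - e q \<in> pm_space C q"
        unfolding span[symmetric] by (simp add: b e_in[OF q] vs.span_base vs.span_diff)
      then show ?thesis
        using one[OF b] one[OF e_in[OF q]]
        by (simp add: S_def \<rho>_def vpair.linear_diff[OF lin])
    qed
    ultimately show ?thesis
      unfolding nonzero_module_def by (metis eq_iff_diff_eq_0 singletonD)
  qed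
  ultimately show ?thesis
    using iso by blast
qed

end
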